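(* Let $G$ and $H$ be two disjoint graphs with $\emptyset\neq X\subseteq V(G)$, $\emptyset\neq Y\subseteq V(H)$ and $|X|=|Y|$, and let $G\cdot_{XY}H$ be the vertex-set coalescence of $G$ and $H$ via $X$ and $Y$. Then: (a) $\gamma(G)+\gamma(H)-|X|\leq\gamma(G\cdot_{XY}H)\leq\gamma(G)+\gamma(H)$; (b) $X$ and $Y$ are strong critical vertex-sets of $G$ and $H$, respectively, if and only if $X$ is a strong critical vertex-set of $G\cdot_{XY}H$; (c) if $X$ is a strong critical vertex-set of $G\cdot_{XY}H$, then $\gamma(G\cdot_{XY}H)=\gamma(G)+\gamma(H)-|X|$.
   Context: All graphs are finite, undirected and simple; two graphs are disjoint if they have no common vertices. A set $D\subseteq V(G)$ is a dominating set of $G$ if every vertex of $G$ is in $D$ or adjacent to a vertex of $D$; the domination number $\gamma(G)$ is the minimum cardinality of a dominating set of $G$ (with the convention that the graph with no vertices has domination number $0$). For $S\subseteq V(G)$, $G-S$ denotes the graph obtained from $G$ by deleting the vertices of $S$. A set $S\subseteq V(G)$ is a strong critical vertex-set (st-critical vertex-set) of $G$ if $\gamma(G-S)=\gamma(G)-|S|$. Vertex-set coalescence: let $X=\{x_1,\ldots,x_m\}\subseteq V(G)$ and $Y=\{y_1,\ldots,y_m\}\subseteq V(H)$ be non-empty sets of the same cardinality $m$, with fixed enumerations. $G\cdot_{XY}H$ is the graph obtained from the union $G\cup H$ by identifying, for every $1\le i\le m$, the vertices $x_i$ and $y_i$ as one vertex, named $x_i$ (the result is regarded as a simple graph, so parallel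 edges are merged). Thus $X$ is also a subset of $V(G\cdot_{XY}H)$. *)

theory Defs
  imports "Graph_Theory.Graph_Theory"
begin

text \<open>
  A finite, undirected, simple graph is a \<^const>\<open>pair_graph\<close>: an undirected edge
  is represented by its two opposite arcs, and the null graph is allowed. Domination and vertex
  deletion are defined for arbitrary \<^typ>\<open>('a, 'b) pre_digraph\<close> values, to which
  \<^const>\<open>with_proj\<close> coerces.
\<close>

definition dominating_set :: "('a, 'b) pre_digraph \<Rightarrow> 'a set \<Rightarrow> bool" where
  "dominating_set G D \<longleftrightarrow>
     D \<subseteq> verts G \<and> (\<forall>v\<in>verts G. v \<in> D \<or> (\<exists>u\<in>D. v \<rightarrow>\<^bsub>G\<^esub> u))"

definition domination_number :: "('a, 'b) pre_digraph \<Rightarrow> nat" where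
  "domination_number G = Min {card D | D. dominating_set G D}"

lemma domination_number_null: "verts G = {} \<Longrightarrow> domination_number G = 0"
  by (simp add: domination_number_def dominating_set_def)

definition del_verts :: "('a, 'b) pre_digraph \<Rightarrow> 'a set \<Rightarrow> ('a, 'b) pre_digraph" where
  "del_verts G S = G \<restriction> (verts G - S)"

text \<open>
  The difference is taken in the integers: truncated subtraction on the natural numbers would
  admit further sets whenever \<open>domination_number G < card S\<close>.
\<close>

definition st_critical :: "('a, 'b) pre_digraph \<Rightarrow> 'a set \<Rightarrow> bool" where
  "st_critical G S \<longleftrightarrow> S \<subseteq> verts G \<and>
     int (domination_number (del_verts G S)) = int (domination_number G) - int (card S)"

text \<open>
  For sets enumerated as \<open>x 1, \<dots>, x m\<close> and \<open>y 1, \<dots>, y m\<close>, the map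
  \<open>identify m x y\<close> renames each \<open>y i\<close> to \<open>x i\<close> and fixes every
  other vertex. The coalescence is the image of the union of the two graphs under this map; since
  the arcs form a set of pairs, parallel edges are merged.
\<close>

definition identify :: "nat \<Rightarrow> (nat \<Rightarrow> 'a) \<Rightarrow> (nat \<Rightarrow> 'a) \<Rightarrow> 'a \<Rightarrow> 'a" where
  "identify m x y v = (if v \<in> y ` {1..m} then x (inv_into {1..m} y v) else v)"

definition coalescence ::
  "'a pair_pre_digraph \<Rightarrow> 'a pair_pre_digraph \<Rightarrow> nat \<Rightarrow> (nat \<Rightarrow> 'a) \<Rightarrow> (nat \<Rightarrow> 'a)
    \<Rightarrow> 'a pair_pre_digraph" where
  "coalescence G H m x y =
     \<lparr> pverts = identify m x y ` (pverts G \<union> pverts H),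
       parcs = map_prod (identify m x y) (identify m x y) ` (parcs G \<union> parcs H) \<rparr>"

lemma identify_enum:
  "inj_on y {1..m} \<Longrightarrow> i \<in> {1..m} \<Longrightarrow> identify m x y (y i) = x i"
  by (simp add: identify_def)

lemma identify_other: "v \<notin> y ` {1..m} \<Longrightarrow> identify m x y v = v"
  by (simp add: identify_def)

lemma pair_graph_coalescence:
  assumes G: "pair_graph G" and H: "pair_graph H"
    and disj: "pverts G \<inter> pverts H = {}"
    and X: "bij_betw x {1..m} X" "X \<subseteq> pverts G"
    and Y: "bij_betw y {1..m} Y" "Y \<subseteq> pverts H"
  shows "pair_graph (coalescence G H m x y)"
proof -
  interpret G: pair_graph G by (rule G)
  interpret H: pair_graph H by (rule H)
  let ?f = "identify m x y"
  have yi: "y ` {1..m} = Y" "inj_on y {1..m}" and xi: "x ` {1..m} = X" "inj_on x {1..m}"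
    using X(1) Y(1) by (auto simp: bij_betw_def)
  have fG: "?f v = v" if "v \<in> pverts G" for v
    using that disj Y(2) yi(1) by (intro identify_other) blast
  have fH: "inj_on ?f (pverts H)"
  proof (rule inj_onI)
    fix u v assume uv: "u \<in> pverts H" "v \<in> pverts H" "?f u = ?f v"
    have inX: "?f w \<in> X" if "w \<in> Y" for w
      using that yi xi identify_enum[OF yi(2)] by auto
    have out: "?f w = w \<and> w \<notin> X" if "w \<in> pverts H" "w \<notin> Y" for w
      using that yi(1) X(2) disj identify_other[of w y m x] by blast
    show "u = v"
    proof (cases "u \<in> Y \<and> v \<in> Y")
      case True
      then obtain i j where "i \<in> {1..m}" "j \<in> {1..m}" "u = y i" "v = y j"
        using yi(1) by blast
      then show ?thesis
        using uv(3) identify_enum[OF yi(2)] inj_onD[OF xi(2)] by metis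
    next
      case False
      then show ?thesis using uv inX out by metis
    qed
  qed
  have noloop: "?f a \<noteq> ?f b" if "(a, b) \<in> parcs G \<union> parcs H" for a b
    using that
  proof
    assume "(a, b) \<in> parcs G"
    then show ?thesis using fG G.no_loops' G.wellformed' by metis
  next
    assume "(a, b) \<in> parcs H"
    then show ?thesis using inj_onD[OF fH] H.no_loops' H.wellformed' by metis
  qed
  have sym: "(b, a) \<in> parcs G \<union> parcs H" if "(a, b) \<in> parcs G \<union> parcs H" for a b
    using that G.arcs_symmetric H.arcs_symmetric by blast
  show ?thesis
  proof (unfold_locales)
    show "symmetric (with_proj (coalescence G H m x y))"
      using sym by (fastforce simp: symmetric_def coalescence_def intro!: symI)
  next
    fix e assume "e \<in> parcs (coalescence G H m x y)"
    then obtain a b where e: "e = (?f a, ?f b)" and ab: "(a, b) \<in> parcs G \<union> parcs H"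
      by (auto simp: coalescence_def)
    show "fst e \<in> pverts (coalescence G H m x y)" "snd e \<in> pverts (coalescence G H m x y)"
      using e ab G.wellformed' H.wellformed' by (auto simp: coalescence_def)
    show "fst e \<noteq> snd e" using e ab noloop by simp
  qed (use G.pair_finite_verts H.pair_finite_verts G.pair_finite_arcs H.pair_finite_arcs
       in \<open>auto simp: coalescence_def\<close>)
qed

end

theory Submission
  imports Defs
begin

text \<open>
  After the vertices of \<open>Y\<close> are renamed to those of \<open>X\<close>, the coalescence is an ordinary union of
  two graphs \<open>A\<close> and \<open>B\<close> whose common vertices form a set \<open>S\<close>, and renaming
  affects neither the domination number nor strong criticality. Write \<open>\<gamma>\<close> for the
  domination number and \<open>C\<close> for the union. Everything follows from four facts about
  \<open>C\<close>:

  \<^item> \<open>\<gamma>(A) + \<gamma>(B) \<le> \<gamma>(C) + |S|\<close>: cut a minimum dominating set of \<open>C\<close> into its two traces. The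
    members of \<open>S\<close> that it contains are counted twice. Every other vertex of \<open>S\<close> is dominated from
    within \<open>A\<close> or from within \<open>B\<close>, so it need be added to at most one of the traces. In total each
    vertex of \<open>S\<close> costs at most one extra.
  \<^item> \<open>\<gamma>(C) \<le> \<gamma>(A) + \<gamma>(B - S)\<close>, and the same with \<open>A\<close> and \<open>B\<close> exchanged: a dominating set of
    \<open>A\<close> already takes care of \<open>S\<close>. Likewise \<open>\<gamma>(C) \<le> \<gamma>(A) + \<gamma>(B)\<close>.
  \<^item> \<open>\<gamma>(C - S) = \<gamma>(A - S) + \<gamma>(B - S)\<close>: this is the case of an empty overlap in the
    preceding facts.
  \<^item> \<open>\<gamma>(K) \<le> \<gamma>(K - T) + |T|\<close> for every finite \<open>K\<close> and \<open>T \<subseteq> V(K)\<close>.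

  If \<open>S\<close> is strong critical in \<open>A\<close> and \<open>B\<close>, then
  \<open>\<gamma>(C - S) = \<gamma>(A) + \<gamma>(B) - 2|S| \<le> \<gamma>(C) - |S|\<close>, and the last fact gives equality.
  Conversely, if \<open>\<gamma>(C - S) = \<gamma>(C) - |S|\<close>, then
  \<open>\<gamma>(A - S) = \<gamma>(C) - |S| - \<gamma>(B - S) \<le> \<gamma>(A) - |S|\<close> by the second fact, so \<open>S\<close> is strong critical in
  \<open>A\<close>, and by symmetry in \<open>B\<close>. Adding up the two equations yields
  \<open>\<gamma>(C) = \<gamma>(A) + \<gamma>(B) - |S|\<close>.
\<close>

section \<open>Domination number, vertex deletion and isomorphism\<close>

lemma finite_dominating_cards:
  assumes "finite (verts G)"
  shows "finite {card D | D. dominating_set G D}"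
proof -
  have "{card D | D. dominating_set G D} \<subseteq> card ` Pow (verts G)"
    by (auto simp: dominating_set_def)
  then show ?thesis
    using assms by (meson finite_Pow_iff finite_imageI finite_subset)
qed

lemma domination_number_le:
  assumes "finite (verts G)" "dominating_set G D"
  shows "domination_number G \<le> card D"
  unfolding domination_number_def
  using finite_dominating_cards[OF assms(1)] assms(2) by (intro Min_le) auto

lemma obtain_minimum_dominating_set:
  assumes "finite (verts G)"
  obtains D where "dominating_set G D" "finite D" "card D = domination_number G"
proof -
  have "dominating_set G (verts G)"
    by (simp add: dominating_set_def)
  then have "domination_number G \<in> {card D | D. dominating_set G D}"
    unfolding domination_number_def
    using finite_dominating_cards[OF assms] by (intro Min_in) auto
  then obtain D where "dominating_set G D" "card D = domination_number G"
    by auto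
  moreover from this have "finite D"
    using assms by (auto simp: dominating_set_def intro: finite_subset)
  ultimately show thesis
    using that by blast
qed

lemma verts_del_verts [simp]: "verts (del_verts G S) = verts G - S"
  by (simp add: del_verts_def)

lemma dominates_del_verts_iff [simp]:
  "u \<rightarrow>\<^bsub>del_verts G S\<^esub> v \<longleftrightarrow>
     u \<rightarrow>\<^bsub>G\<^esub> v \<and> u \<in> verts G - S \<and> v \<in> verts G - S"
  unfolding arcs_ends_conv del_verts_def by force

lemma domination_number_le_del_verts:
  assumes "finite (verts G)" "S \<subseteq> verts G"
  shows "domination_number G \<le> domination_number (del_verts G S) + card S"
proof -
  obtain D where D: "dominating_set (del_verts G S) D" "finite D"
      "card D = domination_number (del_verts G S)"
    using obtain_minimum_dominating_set[of "del_verts G S"] assms(1) by auto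
  have "dominating_set G (D \<union> S)"
    using D(1) assms(2) by (auto simp: dominating_set_def)
  then have "domination_number G \<le> card (D \<union> S)"
    by (rule domination_number_le[OF assms(1)])
  also have "\<dots> \<le> card D + card S"
    by (rule card_Un_le)
  finally show ?thesis
    using D(3) by simp
qed

text \<open>
  Identifying vertices or adding arcs can only help domination, as a homomorphism carries a
  dominating set of its source to one of its image.
\<close>

lemma domination_number_hom_image_le:
  assumes "finite (verts G)" "f ` verts G = verts K"
    and hom: "\<And>u v. u \<in> verts G \<Longrightarrow> v \<in> verts G \<Longrightarrow> u \<rightarrow>\<^bsub>G\<^esub> v \<Longrightarrow> f u \<rightarrow>\<^bsub>K\<^esub> f v"
  shows "domination_number K \<le> domination_number G"
proof -
  obtain D where D: "dominating_set G D" "finite D" "card D = domination_number G"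
    using obtain_minimum_dominating_set[OF assms(1)] by blast
  have "f v \<in> f ` D \<or> (\<exists>u\<in>f ` D. f v \<rightarrow>\<^bsub>K\<^esub> u)" if "v \<in> verts G" for v
    using D(1) that hom unfolding dominating_set_def by blast
  then have "dominating_set K (f ` D)"
    using D(1) unfolding dominating_set_def assms(2)[symmetric] by blast
  then have "domination_number K \<le> card (f ` D)"
    using assms(1,2) by (metis domination_number_le finite_imageI)
  also have "\<dots> \<le> card D"
    using D(2) by (rule card_image_le)
  finally show ?thesis
    using D(3) by simp
qed

lemma domination_number_iso:
  assumes fin: "finite (verts G)" and f: "bij_betw f (verts G) (verts K)"
    and iso: "\<And>u v. u \<in> verts G \<Longrightarrow> v \<in> verts G \<Longrightarrow> u \<rightarrow>\<^bsub>G\<^esub> v \<longleftrightarrow> f u \<rightarrow>\<^bsub>K\<^esub> f v"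
  shows "domination_number K = domination_number G"
proof (rule antisym)
  show "domination_number K \<le> domination_number G"
    using f iso by (intro domination_number_hom_image_le[OF fin, of f]) (auto simp: bij_betw_def)
  let ?g = "inv_into (verts G) f"
  have g: "bij_betw ?g (verts K) (verts G)"
    using f by (rule bij_betw_inv_into)
  have "?g u \<rightarrow>\<^bsub>G\<^esub> ?g v" if "u \<in> verts K" "v \<in> verts K" "u \<rightarrow>\<^bsub>K\<^esub> v" for u v
    using that iso[of "?g u" "?g v"] bij_betw_apply[OF g] bij_betw_inv_into_right[OF f]
    by auto
  moreover have "finite (verts K)"
    using fin f bij_betw_finite by blast
  ultimately show "domination_number G \<le> domination_number K"
    using g by (intro domination_number_hom_image_le[of K ?g]) (auto simp: bij_betw_def)
qed

lemma st_critical_iso: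
  assumes fin: "finite (verts G)" and f: "bij_betw f (verts G) (verts K)"
    and iso: "\<And>u v. u \<in> verts G \<Longrightarrow> v \<in> verts G \<Longrightarrow> u \<rightarrow>\<^bsub>G\<^esub> v \<longleftrightarrow> f u \<rightarrow>\<^bsub>K\<^esub> f v"
    and S: "S \<subseteq> verts G"
  shows "st_critical K (f ` S) \<longleftrightarrow> st_critical G S"
proof -
  have inj: "inj_on f (verts G)" and im: "f ` verts G = verts K"
    using f by (auto simp: bij_betw_def)
  have diff: "f ` (verts G - S) = verts K - f ` S"
    using inj_on_image_set_diff[OF inj, of "verts G" S] im S by auto
  then have "bij_betw f (verts (del_verts G S)) (verts (del_verts K (f ` S)))"
    using inj by (auto simp: bij_betw_def intro: inj_on_subset)
  moreover have "u \<rightarrow>\<^bsub>del_verts G S\<^esub> v \<longleftrightarrow> f u \<rightarrow>\<^bsub>del_verts K (f ` S)\<^esub> f v"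
    if "u \<in> verts (del_verts G S)" "v \<in> verts (del_verts G S)" for u v
  proof -
    have "f u \<in> verts K - f ` S" "f v \<in> verts K - f ` S"
      using that diff by auto
    then show ?thesis
      using that iso[of u v] by auto
  qed
  ultimately have "domination_number (del_verts K (f ` S)) = domination_number (del_verts G S)"
    using fin by (intro domination_number_iso) auto
  moreover have "domination_number K = domination_number G"
    by (rule domination_number_iso[OF fin f iso])
  moreover have "card (f ` S) = card S"
    using inj S by (meson card_image inj_on_subset)
  moreover have "f ` S \<subseteq> verts K"
    using im S by auto
  ultimately show ?thesis
    using S by (simp add: st_critical_def)
qed

section \<open>Unions of two graphs that overlap in a vertex set\<close>

text \<open>
  No arc of the union joins a vertex outside \<open>B\<close> to a vertex outside \<open>A\<close>; this is what
  well-formedness of the two parts provides. The arc sets may overlap, since coalescence merges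
  parallel edges.
\<close>

locale graph_union =
  A: wf_digraph A + B: wf_digraph B
  for A :: "('a, 'b) pre_digraph" and B :: "('a, 'c) pre_digraph" +
  fixes C :: "('a, 'd) pre_digraph"
  assumes finite_A: "finite (verts A)" and finite_B: "finite (verts B)"
    and verts_C: "verts C = verts A \<union> verts B"
    and arcs_ends_C: "arcs_ends C = arcs_ends A \<union> arcs_ends B"
begin

abbreviation overlap :: "'a set" where
  "overlap \<equiv> verts A \<inter> verts B"

lemma swapped: "graph_union B A C"
  using finite_A finite_B verts_C arcs_ends_C by unfold_locales auto

lemma finite_C: "finite (verts C)"
  using finite_A finite_B verts_C by simp

lemma domination_number_sum_le:
  "domination_number A + domination_number B \<le> domination_number C + card overlap"
proof -
  obtain D where D: "dominating_set C D" "finite D" "card D = domination_number C"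
    using obtain_minimum_dominating_set[OF finite_C] by blast
  have dom: "v \<in> D \<or> (\<exists>u\<in>D. v \<rightarrow>\<^bsub>A\<^esub> u \<or> v \<rightarrow>\<^bsub>B\<^esub> u)" if "v \<in> verts A \<union> verts B" for v
    using D(1) that by (auto simp: dominating_set_def verts_C arcs_ends_C)
  have sub: "D \<subseteq> verts A \<union> verts B"
    using D(1) by (simp add: dominating_set_def verts_C)
  \<comment> \<open>The shared vertices that need no help in \<open>A\<close>; those outside \<open>D \<union> T\<close> are dominated from within \<open>B\<close>.\<close>
  define T where "T = {v \<in> overlap - D. \<exists>u\<in>D. v \<rightarrow>\<^bsub>A\<^esub> u}"
  define DA where "DA = (D \<inter> verts A) \<union> (overlap - D - T)"
  define DB where "DB = (D \<inter> verts B) \<union> T"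
  have "v \<in> DA \<or> (\<exists>u\<in>DA. v \<rightarrow>\<^bsub>A\<^esub> u)" if "v \<in> verts A" for v
    using that dom[of v] A.adj_in_verts B.adj_in_verts unfolding DA_def T_def by blast
  then have "dominating_set A DA"
    by (auto simp: dominating_set_def DA_def)
  then have A: "domination_number A \<le> card DA"
    by (rule domination_number_le[OF finite_A])
  have "v \<in> DB \<or> (\<exists>u\<in>DB. v \<rightarrow>\<^bsub>B\<^esub> u)" if "v \<in> verts B" for v
    using that dom[of v] A.adj_in_verts B.adj_in_verts unfolding DB_def T_def by blast
  then have "dominating_set B DB"
    by (auto simp: dominating_set_def DB_def T_def)
  then have B: "domination_number B \<le> card DB"
    by (rule domination_number_le[OF finite_B])
  have T: "T \<subseteq> overlap - D"
    by (auto simp: T_def)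
  have fin: "finite overlap" "finite T"
    using finite_A T by (auto intro: finite_subset)
  have "card DA \<le> card (D \<inter> verts A) + card (overlap - D - T)"
    unfolding DA_def by (rule card_Un_le)
  moreover have "card DB \<le> card (D \<inter> verts B) + card T"
    unfolding DB_def by (rule card_Un_le)
  moreover have "card (D \<inter> verts A) + card (D \<inter> verts B) = card D + card (D \<inter> overlap)"
  proof -
    have "D \<inter> verts A \<union> D \<inter> verts B = D" "D \<inter> verts A \<inter> (D \<inter> verts B) = D \<inter> overlap"
      using sub by auto
    then show ?thesis
      using card_Un_Int[of "D \<inter> verts A" "D \<inter> verts B"] D(2) by simp
  qed
  moreover have "card (overlap - D - T) + card T = card (overlap - D)"
    using card_Diff_subset[OF fin(2) T] card_mono[OF _ T] fin(1) by simp
  moreover have "card (overlap - D) + card (D \<inter> overlap) = card overlap"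
    using card_Int_Diff[OF fin(1), of D] by (simp add: Int_commute)
  ultimately show ?thesis
    using A B D(3) by linarith
qed

text \<open>
  The second part may leave \<open>overlap\<close> undominated, as any dominating set of \<open>A\<close> covers it. This
  common form serves both a dominating set of \<open>B\<close> and one of \<open>B\<close> with \<open>overlap\<close> deleted.
\<close>

lemma domination_number_le_partial:
  assumes "D \<subseteq> verts B" "\<And>v. v \<in> verts B - overlap \<Longrightarrow> v \<in> D \<or> (\<exists>u\<in>D. v \<rightarrow>\<^bsub>B\<^esub> u)"
  shows "domination_number C \<le> domination_number A + card D"
proof -
  obtain E where E: "dominating_set A E" "card E = domination_number A"
    using obtain_minimum_dominating_set[OF finite_A] by blast
  have "dominating_set C (E \<union> D)"
    using E(1) assms unfolding dominating_set_def verts_C arcs_ends_C by blast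
  then have "domination_number C \<le> card (E \<union> D)"
    by (rule domination_number_le[OF finite_C])
  also have "\<dots> \<le> card E + card D"
    by (rule card_Un_le)
  finally show ?thesis
    using E(2) by simp
qed

lemma domination_number_le_sum:
  "domination_number C \<le> domination_number A + domination_number B"
proof -
  obtain D where "dominating_set B D" "card D = domination_number B"
    using obtain_minimum_dominating_set[OF finite_B] by blast
  then show ?thesis
    using domination_number_le_partial[of D] by (auto simp: dominating_set_def)
qed

lemma domination_number_le_sum_del:
  "domination_number C \<le> domination_number A + domination_number (del_verts B overlap)"
proof -
  obtain D where D: "dominating_set (del_verts B overlap) D"
      "card D = domination_number (del_verts B overlap)"
    using obtain_minimum_dominating_set[of "del_verts B overlap"] finite_B by auto
  have "domination_number C \<le> domination_number A + card D"
    using D(1) by (intro domination_number_le_partial) (auto simp: dominating_set_def)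
  then show ?thesis
    using D(2) by simp
qed

lemma graph_union_del_overlap:
  "graph_union (del_verts A overlap) (del_verts B overlap) (del_verts C overlap)"
proof -
  have "wf_digraph (del_verts A overlap)" "wf_digraph (del_verts B overlap)"
    unfolding del_verts_def by auto
  moreover have "arcs_ends (del_verts C overlap) =
      arcs_ends (del_verts A overlap) \<union> arcs_ends (del_verts B overlap)"
  proof (rule set_eqI)
    fix e
    show "e \<in> arcs_ends (del_verts C overlap) \<longleftrightarrow>
        e \<in> arcs_ends (del_verts A overlap) \<union> arcs_ends (del_verts B overlap)"
      using A.adj_in_verts B.adj_in_verts
      by (cases e) (auto simp: arcs_ends_C verts_C)
  qed
  ultimately show ?thesis
    using finite_A finite_B
    by (auto simp: graph_union_def graph_union_axioms_def verts_C)
qed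

lemma domination_number_del_overlap:
  "domination_number (del_verts C overlap) =
     domination_number (del_verts A overlap) + domination_number (del_verts B overlap)"
proof -
  interpret del: graph_union "del_verts A overlap" "del_verts B overlap" "del_verts C overlap"
    by (rule graph_union_del_overlap)
  have "del.overlap = {}"
    by auto
  then show ?thesis
    using del.domination_number_sum_le del.domination_number_le_sum by simp
qed

lemma st_critical_overlap_iff:
  "st_critical A overlap \<and> st_critical B overlap \<longleftrightarrow> st_critical C overlap"
proof -
  note split = domination_number_del_overlap
  have A: "domination_number A \<le> domination_number (del_verts A overlap) + card overlap"
    by (rule domination_number_le_del_verts[OF finite_A]) simp
  have B: "domination_number B \<le> domination_number (del_verts B overlap) + card overlap"
    by (rule domination_number_le_del_verts[OF finite_B]) simp
  have C: "domination_number C \<le> domination_number (del_verts C overlap) + card overlap"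
    using verts_C by (intro domination_number_le_del_verts[OF finite_C]) auto
  have up: "domination_number C \<le> domination_number B + domination_number (del_verts A overlap)"
    using graph_union.domination_number_le_sum_del[OF swapped] by (simp add: Int_commute)
  have sub: "overlap \<subseteq> verts A" "overlap \<subseteq> verts B" "overlap \<subseteq> verts C"
    using verts_C by auto
  show ?thesis
    unfolding st_critical_def
    using sub split A B C up domination_number_le_sum_del domination_number_sum_le
    by (auto simp del: Int_subset_iff)
qed

lemma domination_number_if_st_critical:
  assumes "st_critical C overlap"
  shows "int (domination_number C) =
    int (domination_number A) + int (domination_number B) - int (card overlap)"
proof -
  have "st_critical A overlap" "st_critical B overlap"
    using assms st_critical_overlap_iff by auto
  then show ?thesis
    using assms domination_number_del_overlap by (simp add: st_critical_def)
qed

end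

section \<open>Coalescence as a union\<close>

text \<open>
  With \<open>V\<close> and \<open>W\<close> the vertex sets of the two graphs, renaming is injective on \<open>W\<close> because it maps
  \<open>Y\<close> bijectively to \<open>X\<close>, which \<open>W\<close> avoids, and fixes the rest. The renamed copy of the second
  graph is therefore isomorphic to it and shares with the first one just the vertices of \<open>X\<close>.
\<close>

lemma identify_on_second_graph:
  assumes disj: "V \<inter> W = {}" and X: "bij_betw x {1..m} X" "X \<subseteq> V"
    and Y: "bij_betw y {1..m} Y" "Y \<subseteq> W"
  shows "inj_on (identify m x y) W" "identify m x y ` Y = X" "V \<inter> identify m x y ` W = X"
proof -
  let ?f = "identify m x y"
  have Yim: "y ` {1..m} = Y" and Yinj: "inj_on y {1..m}"
    using Y(1) by (auto simp: bij_betw_def)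
  have on_Y: "?f v = (x \<circ> inv_into {1..m} y) v" if "v \<in> Y" for v
    using that Yim by (simp add: identify_def)
  have other: "?f v = v" if "v \<notin> Y" for v
    using that Yim by (intro identify_other) simp
  have "bij_betw (x \<circ> inv_into {1..m} y) Y X"
    using bij_betw_trans[OF bij_betw_inv_into[OF Y(1)] X(1)] .
  then have bij: "bij_betw ?f Y X"
    using on_Y by (simp cong: bij_betw_cong)
  then show img: "?f ` Y = X"
    by (simp add: bij_betw_def)
  have "?f ` (W - Y) = W - Y"
    using other by force
  then have "inj_on ?f (Y \<union> (W - Y))"
    using bij img disj X(2) other by (subst inj_on_Un) (auto simp: bij_betw_def inj_on_def)
  then show "inj_on ?f W"
    using Y(2) by (simp add: Un_absorb1)
  have "?f ` W = X \<union> (W - Y)"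
    using img \<open>?f ` (W - Y) = W - Y\<close> Y(2) by (metis Diff_partition image_Un)
  then show "V \<inter> ?f ` W = X"
    using disj X(2) by auto
qed

theorem theorem2:
  fixes G H :: "'a pair_pre_digraph" and X Y :: "'a set" and x y :: "nat \<Rightarrow> 'a"
  assumes "pair_graph G" and "pair_graph H"
    and "pverts G \<inter> pverts H = {}"
    and "X \<noteq> {}" and "X \<subseteq> pverts G"
    and "Y \<noteq> {}" and "Y \<subseteq> pverts H"
    and "card X = card Y"
    and "bij_betw x {1..card X} X" and "bij_betw y {1..card Y} Y"
  shows "(int (domination_number G) + int (domination_number H) - int (card X)
            \<le> int (domination_number (coalescence G H (card X) x y))
          \<and> domination_number (coalescence G H (card X) x y)
            \<le> domination_number G + domination_number H)
       \<and> (st_critical G X \<and> st_critical H Y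
            \<longleftrightarrow> st_critical (coalescence G H (card X) x y) X)
       \<and> (st_critical (coalescence G H (card X) x y) X
            \<longrightarrow> int (domination_number (coalescence G H (card X) x y))
                = int (domination_number G) + int (domination_number H) - int (card X))"
proof -
  let ?f = "identify (card X) x y" and ?C = "coalescence G H (card X) x y"
  define K where "K = \<lparr>pverts = ?f ` pverts H, parcs = map_prod ?f ?f ` parcs H\<rparr>"
  interpret G: pair_graph G by (rule assms(1))
  interpret H: pair_graph H by (rule assms(2))
  have bij_y: "bij_betw y {1..card X} Y"
    using assms(8,10) by simp
  note f = identify_on_second_graph[OF assms(3,9,5) bij_y assms(7)]
  have fG: "?f v = v" if "v \<in> pverts G" for v
    using that assms(3,7) bij_y by (intro identify_other) (auto simp: bij_betw_def)
  have "map_prod ?f ?f e = e" if "e \<in> parcs G" for e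
    using that fG G.wellformed' by (cases e) auto
  then have im_G: "?f ` pverts G = pverts G" "map_prod ?f ?f ` parcs G = parcs G"
    using fG by force+
  have "pair_wf_digraph K"
    using H.wellformed' by (auto simp: pair_wf_digraph_def K_def)
  then have "wf_digraph (with_proj K)"
    by (simp add: wf_digraph_wp_iff)
  then interpret graph_union G K ?C
    using G.pair_finite_verts H.pair_finite_verts im_G
    by (auto simp: graph_union_def graph_union_axioms_def K_def coalescence_def image_Un
        G.wf_digraph)
  have overlap: "verts G \<inter> verts K = X"
    using f(3) by (simp add: K_def)
  have iso: "u \<rightarrow>\<^bsub>H\<^esub> v \<longleftrightarrow> ?f u \<rightarrow>\<^bsub>K\<^esub> ?f v" if "u \<in> verts H" "v \<in> verts H" for u v
  proof
    assume "?f u \<rightarrow>\<^bsub>K\<^esub> ?f v"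
    then obtain a b where ab: "(a, b) \<in> parcs H" "?f u = ?f a" "?f v = ?f b"
      by (auto simp: K_def)
    moreover from this have "u = a" "v = b"
      using that H.wellformed' by (auto intro: inj_onD[OF f(1)])
    ultimately show "u \<rightarrow>\<^bsub>H\<^esub> v"
      by simp
  qed (force simp: K_def)
  have bij: "bij_betw ?f (verts H) (verts K)"
    using f(1) by (simp add: bij_betw_def K_def)
  have "finite (verts H)"
    using H.pair_finite_verts by simp
  then have "domination_number K = domination_number H"
    and "st_critical K X \<longleftrightarrow> st_critical H Y"
    using domination_number_iso[OF _ bij iso] st_critical_iso[OF _ bij iso, of Y] assms(7) f(2)
    by auto
  then show ?thesis
    using domination_number_sum_le domination_number_le_sum st_critical_overlap_iff
      domination_number_if_st_critical
    unfolding overlap by auto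
qed

end
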